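(* Let $\Omega$, $\Upsilon$, $\Gamma$ be finite sets with functions $f:\Omega\to\Upsilon$ and $g:\Upsilon\to\Gamma$, and regard $V_\Upsilon$ and $V_\Gamma$ as subspaces of $V_\Omega=\mathbb{R}^\Omega$ via $f$ and $g\circ f$ respectively, so that $V_\Gamma\le V_\Upsilon\le V_\Omega$. Let $\mathcal{P}$, $\mathcal{Q}$, $\mathcal{R}$ be sets of $\Omega\times\Omega$ matrices specifying orthogonal decompositions of $V_\Omega$, $V_\Upsilon$, $V_\Gamma$, respectively. Suppose that $\mathcal{Q}$ is structure balanced in relation to $\mathcal{P}$ with efficiency matrix $\Lambda_{\mathcal{P}\mathcal{Q}}=(\lambda_{\mathbf{P}\mathbf{Q}})_{\mathbf{P}\in\mathcal{P},\mathbf{Q}\in\mathcal{Q}}$, and that $\mathcal{R}$ is structure balanced in relation to $\mathcal{Q}$ with efficiency matrix $\Lambda_{\mathcal{Q}\mathcal{R}}=(\lambda_{\mathbf{Q}\mathbf{R}})_{\mathbf{Q}\in\mathcal{Q},\mathbf{R}\in\mathcal{R}}$. Then: (a) $\mathcal{R}$ is structure balanced in relation to $\mathcal{P}$ with efficiency matrix $\Lambda_{\mathcal{P}\mathcal{R}}=\Lambda_{\mathcal{P}\mathcal{Q}}\Lambda_{\mathcal{Q}\mathcal{R}}$ (matrix product). (b) $\mathcal{R}$ is structure balanced in relation to $\mathcal{P}\triangleright\mathcal{Q}$, with efficiency factors $\lambda_{\mathbf{P}\triangleright\mathbf{Q},\mathbf{R}}=\lambda_{\mathbf{P}\mathbf{Q}}\lambda_{\mathbf{Q}\mathbf{R}}$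 (for $\mathbf{P}\in\mathcal{P}$, $\mathbf{Q}\in\mathcal{Q}$ with $\lambda_{\mathbf{P}\mathbf{Q}}\ne0$, and $\mathbf{R}\in\mathcal{R}$) and $\lambda_{\mathbf{P}\vdash\mathcal{Q},\mathbf{R}}=0$ (for $\mathbf{P}\in\mathcal{P}$, $\mathbf{R}\in\mathcal{R}$). (c) $\mathcal{Q}\triangleright\mathcal{R}$ is structure balanced in relation to $\mathcal{P}$, with efficiency factors $\lambda_{\mathbf{P},\mathbf{Q}\triangleright\mathbf{R}}=\lambda_{\mathbf{P}\mathbf{Q}}$ (for $\mathbf{P}\in\mathcal{P}$, $\mathbf{Q}\in\mathcal{Q}$, $\mathbf{R}\in\mathcal{R}$ with $\lambda_{\mathbf{Q}\mathbf{R}}\neq0$) and $\lambda_{\mathbf{P},\mathbf{Q}\vdash\mathcal{R}}=\lambda_{\mathbf{P}\mathbf{Q}}$ (for $\mathbf{P}\in\mathcal{P}$, $\mathbf{Q}\in\mathcal{Q}$). (d) The decompositions $(\mathcal{P}\triangleright\mathcal{Q})\triangleright\mathcal{R}$ and $\mathcal{P}\triangleright(\mathcal{Q}\triangleright\mathcal{R})$ of $V_\Omega$ are equal, and both are equal to $$\{(\mathbf{P}\triangleright\mathbf{Q})\triangleright\mathbf{R}:\mathbf{P}\in\mathcal{P},\mathbf{Q}\in\mathcal{Q},\mathbf{R}\in\mathcal{R},\lambda_{\mathbf{P}\mathbf{Q}}\ne0,\lambda_{\mathbf{Q}\mathbf{R}}\ne0\}\cup\{(\mathbf{P}\triangleri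ght\mathbf{Q})\vdash\mathcal{R}:\mathbf{P}\in\mathcal{P},\mathbf{Q}\in\mathcal{Q},\lambda_{\mathbf{P}\mathbf{Q}}\ne0\}\cup\{\mathbf{P}\vdash\mathcal{Q}:\mathbf{P}\in\mathcal{P}\}.$$
   Context: For a finite set $\Omega$, $V_\Omega=\mathbb{R}^\Omega$ is the real vector space of vectors indexed by $\Omega$, with the standard inner product; an $\Omega\times\Omega$ matrix has rows and columns labelled by $\Omega$. Given $f:\Omega\to\Upsilon$, the space $V_\Upsilon$ is regarded as a subspace of $V_\Omega$, namely the column space of the $\Omega\times\Upsilon$ matrix whose $(\omega,t)$-entry is $1$ if $f(\omega)=t$ and $0$ otherwise. Similarly, $V_\Gamma$ is regarded as a subspace of $V_\Omega$ via $g\circ f:\Omega\to\Gamma$. A set $\mathcal{Q}$ of $\Omega\times\Omega$ matrices specifies an orthogonal decomposition (also called a structure) of a subspace $V\le V_\Omega$ if its elements are nonzero symmetric idempotent matrices, $\mathbf{Q}_1\mathbf{Q}_2=\mathbf{0}$ for distinct $\mathbf{Q}_1,\mathbf{Q}_2\in\mathcal{Q}$, and $\sum_{\mathbf{Q}\in\mathcal{Q}}\mathbf{Q}=\mathbf{I}_{\mathcal{Q}}$, where $\mathbf{I}_{\mathcal{Q}}$ is the matrix of orthogonal projection of $V_\Omega$ onto $V$. Let $\mathcal{P}$ and $\mathcal{Q}$ specify orthogonal decompositions of subspaces $W$ and $V$ of $V_\Omega$ with $V\le W$. Then $\mathcal{Q}$ is structure balanced in relation to $\mathcal{P}$ if there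 are scalars $\lambda_{\mathbf{P}\mathbf{Q}}$ (for $\mathbf{P}\in\mathcal{P}$, $\mathbf{Q}\in\mathcal{Q}$), called efficiency factors, such that (i) $\mathbf{Q}\mathbf{P}\mathbf{Q}=\lambda_{\mathbf{P}\mathbf{Q}}\mathbf{Q}$ for all $\mathbf{P}\in\mathcal{P}$ and $\mathbf{Q}\in\mathcal{Q}$; and (ii) $\mathbf{Q}_1\mathbf{P}\mathbf{Q}_2=\mathbf{0}$ for all $\mathbf{P}\in\mathcal{P}$ and all $\mathbf{Q}_1\ne\mathbf{Q}_2$ in $\mathcal{Q}$. The efficiency matrix $\Lambda_{\mathcal{P}\mathcal{Q}}$ is the $\mathcal{P}\times\mathcal{Q}$ matrix with entries $\lambda_{\mathbf{P}\mathbf{Q}}$. When $\mathcal{Q}$ is structure balanced in relation to $\mathcal{P}$: - for $\lambda_{\mathbf{P}\mathbf{Q}}\ne0$, $\mathbf{P}\triangleright\mathbf{Q}:=\lambda_{\mathbf{P}\mathbf{Q}}^{-1}\mathbf{P}\mathbf{Q}\mathbf{P}$; - $\mathbf{P}\vdash\mathcal{Q}:=\mathbf{P}-\sum_{\mathbf{Q}\in\mathcal{Q},\,\lambda_{\mathbf{P}\mathbf{Q}}\neq0}\mathbf{P}\triangleright\mathbf{Q}$; - $\mathcal{P}\triangleright\mathcal{Q}:=\{\mathbf{P}\triangleright\mathbf{Q}:\mathbf{P}\in\mathcal{P},\mathbf{Q}\in\mathcal{Q},\lambda_{\mathbf{P}\mathbf{Q}}\ne0\}\cup\{\mathbf{P}\vdash\mathcal{Q}:\mathbf{P}\in\mathcal{P}\}$,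 which specifies an orthogonal decomposition of the same space as $\mathcal{P}$. Convention: any zero matrix arising in such a set (e.g. some $\mathbf{P}\vdash\mathcal{Q}$ equal to $\mathbf{0}$) is discarded, and statements about its efficiency factors are to be read as void (or trivially true); equality of decompositions means equality of the sets of nonzero matrices. *)

theory Defs
  imports "HOL-Analysis.Analysis"
begin

text \<open>
  The finite set \<open>\<Omega>\<close> is a finite type \<^typ>\<open>'o\<close>, and a matrix with rows and columns labelled by
  \<open>\<Omega>\<close> has type \<^typ>\<open>real ^ 'o ^ 'o\<close>.
\<close>

definition incidence :: "('o::finite \<Rightarrow> 'u::finite) \<Rightarrow> real ^ 'u ^ 'o" where
  "incidence f = (\<chi> \<omega> t. if f \<omega> = t then 1 else 0)"

text \<open>The space of vectors indexed by the codomain of \<open>f\<close>, regarded as a subspace of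
  \<^typ>\<open>real ^ 'o\<close>: the column space of the incidence matrix.\<close>

definition induced_space :: "('o::finite \<Rightarrow> 'u::finite) \<Rightarrow> (real ^ 'o) set" where
  "induced_space f = span (columns (incidence f))"

definition orth_projection_matrix :: "(real ^ 'o::finite) set \<Rightarrow> real ^ 'o ^ 'o \<Rightarrow> bool" where
  "orth_projection_matrix V A \<longleftrightarrow>
     (\<forall>x. A *v x \<in> V \<and> (\<forall>v\<in>V. orthogonal (x - A *v x) v))"

text \<open>Finiteness is made explicit because \<^const>\<open>sum\<close> is \<open>0\<close> on infinite sets.\<close>

definition orth_decomposition ::
    "(real ^ 'o::finite) set \<Rightarrow> (real ^ 'o ^ 'o) set \<Rightarrow> bool" where
  "orth_decomposition V \<Q> \<longleftrightarrow>
     subspace V \<and> finite \<Q> \<and>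
     (\<forall>Q\<in>\<Q>. Q \<noteq> 0 \<and> transpose Q = Q \<and> Q ** Q = Q) \<and>
     (\<forall>Q1\<in>\<Q>. \<forall>Q2\<in>\<Q>. Q1 \<noteq> Q2 \<longrightarrow> Q1 ** Q2 = 0) \<and>
     orth_projection_matrix V (\<Sum>Q\<in>\<Q>. Q)"

text \<open>\<open>structure_balanced V \<Q> W \<P>\<close>: the decomposition \<open>\<Q>\<close> of \<open>V\<close> is structure balanced in relation
  to the decomposition \<open>\<P>\<close> of \<open>W\<close>.\<close>

definition structure_balanced ::
    "(real ^ 'o::finite) set \<Rightarrow> (real ^ 'o ^ 'o) set \<Rightarrow>
     (real ^ 'o) set \<Rightarrow> (real ^ 'o ^ 'o) set \<Rightarrow> bool" where
  "structure_balanced V \<Q> W \<P> \<longleftrightarrow>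
     orth_decomposition W \<P> \<and> orth_decomposition V \<Q> \<and> V \<subseteq> W \<and>
     (\<exists>l :: real ^ 'o ^ 'o \<Rightarrow> real ^ 'o ^ 'o \<Rightarrow> real.
        \<forall>P\<in>\<P>. \<forall>Q\<in>\<Q>. Q ** P ** Q = l P Q *\<^sub>R Q) \<and>
     (\<forall>P\<in>\<P>. \<forall>Q1\<in>\<Q>. \<forall>Q2\<in>\<Q>. Q1 \<noteq> Q2 \<longrightarrow> Q1 ** P ** Q2 = 0)"

text \<open>The entry \<open>\<lambda>\<^sub>P\<^sub>Q\<close> of the efficiency matrix. Under structure balance the scalar exists, and it
  is unique because \<open>Q \<noteq> 0\<close>; it depends on \<open>P\<close> and \<open>Q\<close> only.\<close>

definition efficiency :: "real ^ 'o::finite ^ 'o \<Rightarrow> real ^ 'o ^ 'o \<Rightarrow> real" where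
  "efficiency P Q = (THE c. Q ** P ** Q = c *\<^sub>R Q)"

lemma efficiency_eqI:
  assumes "Q \<noteq> 0" and "Q ** P ** Q = c *\<^sub>R Q"
  shows "efficiency P Q = c"
  unfolding efficiency_def
proof (rule the_equality)
  show "Q ** P ** Q = c *\<^sub>R Q" by (rule assms(2))
next
  fix d assume "Q ** P ** Q = d *\<^sub>R Q"
  then have "d *\<^sub>R Q = c *\<^sub>R Q" unfolding assms(2) by (rule sym)
  then show "d = c" using assms(1) unfolding scaleR_cancel_right by (elim disjE) simp_all
qed

lemma structure_balanced_efficiency:
  assumes "structure_balanced V \<Q> W \<P>" and "P \<in> \<P>" and "Q \<in> \<Q>"
  shows "Q ** P ** Q = efficiency P Q *\<^sub>R Q"
proof -
  from assms(1) obtain l where "\<forall>P\<in>\<P>. \<forall>Q\<in>\<Q>. Q ** P ** Q = l P Q *\<^sub>R Q"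
    unfolding structure_balanced_def by (elim conjE exE)
  then have l: "Q ** P ** Q = l P Q *\<^sub>R Q" using assms(2,3) by blast
  have "\<forall>Q\<in>\<Q>. Q \<noteq> 0 \<and> transpose Q = Q \<and> Q ** Q = Q"
    using assms(1) unfolding structure_balanced_def orth_decomposition_def by (elim conjE)
  then have "Q \<noteq> 0" using assms(3) by blast
  then show ?thesis using efficiency_eqI[OF _ l] l by simp
qed

text \<open>Meaningful only for \<open>efficiency P Q \<noteq> 0\<close>.\<close>

definition mat_refine ::
    "real ^ 'o::finite ^ 'o \<Rightarrow> real ^ 'o ^ 'o \<Rightarrow> real ^ 'o ^ 'o"  (infixl "\<rhd>" 75) where
  "P \<rhd> Q = inverse (efficiency P Q) *\<^sub>R (P ** Q ** P)"

definition mat_residual ::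
    "real ^ 'o::finite ^ 'o \<Rightarrow> (real ^ 'o ^ 'o) set \<Rightarrow> real ^ 'o ^ 'o"  (infixl "\<turnstile>" 75) where
  "P \<turnstile> \<Q> = P - (\<Sum>Q \<in> {Q \<in> \<Q>. efficiency P Q \<noteq> 0}. P \<rhd> Q)"

text \<open>Zero matrices are discarded.\<close>

definition set_refine ::
    "(real ^ 'o::finite ^ 'o) set \<Rightarrow> (real ^ 'o ^ 'o) set \<Rightarrow> (real ^ 'o ^ 'o) set"
    (infixl "\<rhd>\<^sub>S" 75) where
  "\<P> \<rhd>\<^sub>S \<Q> =
     ({P \<rhd> Q | P Q. P \<in> \<P> \<and> Q \<in> \<Q> \<and> efficiency P Q \<noteq> 0} \<union> {P \<turnstile> \<Q> | P. P \<in> \<P>}) - {0}"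

end

theory Submission
  imports Defs
begin

text \<open>
  Write \<open>\<Pi>\<close> for the sum of \<open>\<Q>\<close>. Structure balance of \<open>\<Q>\<close> in relation to \<open>\<P>\<close> says exactly that
  \<open>\<Pi> ** P ** \<Pi> = (\<Sum>Q\<in>\<Q>. \<lambda>\<^sub>P\<^sub>Q *\<^sub>R Q)\<close> for every \<open>P \<in> \<P>\<close>. Since the space decomposed by \<open>\<R>\<close> is contained in
  that decomposed by \<open>\<Q>\<close>, every \<open>R \<in> \<R>\<close> is absorbed by \<open>\<Pi>\<close> on both sides, so that
  \<open>R\<^sub>1 ** P ** R\<^sub>2 = (\<Sum>Q\<in>\<Q>. \<lambda>\<^sub>P\<^sub>Q *\<^sub>R (R\<^sub>1 ** Q ** R\<^sub>2))\<close> and \<open>Q ** P ** R = \<lambda>\<^sub>P\<^sub>Q *\<^sub>R (Q ** R)\<close>. The first identity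
  gives (a), and together with the second one it yields (b) and (d). For (c), the refinement
  replaces each \<open>Q\<close> by orthogonal idempotents \<open>X\<close> with sum \<open>Q\<close>, and \<open>Q ** X = X = X ** Q\<close> then gives
  \<open>X ** P ** X = X ** Q ** P ** Q ** X = \<lambda>\<^sub>P\<^sub>Q *\<^sub>R X\<close>.
\<close>

section \<open>Orthogonal families of idempotents\<close>

text \<open>Boundedness is automatic in finite dimension. The interpretation that follows is the
  aim: it supplies distributivity over sums, differences and scalars for all later
  calculations.\<close>

lemma bounded_bilinear_matrix_mult:
  "bounded_bilinear ((**) :: real ^ 'n::finite ^ 'm::finite \<Rightarrow> real ^ 'p::finite ^ 'n \<Rightarrow> real ^ 'p ^ 'm)"
  unfolding bilinear_conv_bounded_bilinear[symmetric] bilinear_def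
  by (auto intro!: linearI simp: matrix_matrix_mult_def vec_eq_iff sum.distrib sum_distrib_left
      algebra_simps)

interpretation matrix_mult: bounded_bilinear
  "(**) :: real ^ 'n::finite ^ 'm::finite \<Rightarrow> real ^ 'p::finite ^ 'n \<Rightarrow> real ^ 'p ^ 'm"
  by (rule bounded_bilinear_matrix_mult)

lemma linear_transpose: "linear (transpose :: real ^ 'n::finite ^ 'm::finite \<Rightarrow> real ^ 'm ^ 'n)"
  by (rule linearI) (simp_all add: transpose_def vec_eq_iff)

text \<open>The purely algebraic part of \<open>orth_decomposition\<close>. The subspace enters the
  argument only through the projection \<open>\<Sum>\<Q>\<close>.\<close>

definition orth_idempotents :: "(real ^ 'o::finite ^ 'o) set \<Rightarrow> bool" where
  "orth_idempotents S \<longleftrightarrow> finite S \<and>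
     (\<forall>A\<in>S. A \<noteq> 0 \<and> transpose A = A \<and> A ** A = A) \<and>
     (\<forall>A\<in>S. \<forall>B\<in>S. A \<noteq> B \<longrightarrow> A ** B = 0)"

lemma orth_decomposition_iff:
  "orth_decomposition V \<Q> \<longleftrightarrow>
     subspace V \<and> orth_idempotents \<Q> \<and> orth_projection_matrix V (\<Sum>\<Q>)"
  unfolding orth_decomposition_def orth_idempotents_def by auto

context
  fixes S :: "(real ^ 'o::finite ^ 'o) set"
  assumes S: "orth_idempotents S"
begin

lemma orth_idempotents_finite: "finite S"
  using S by (simp add: orth_idempotents_def)

lemma orth_idempotents_nonzero: "A \<in> S \<Longrightarrow> A \<noteq> 0"
  using S by (simp add: orth_idempotents_def)

lemma orth_idempotents_transpose: "A \<in> S \<Longrightarrow> transpose A = A"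
  using S by (simp add: orth_idempotents_def)

lemma orth_idempotents_idem: "A \<in> S \<Longrightarrow> A ** A = A"
  using S by (simp add: orth_idempotents_def)

lemma orth_idempotents_orth: "A \<in> S \<Longrightarrow> B \<in> S \<Longrightarrow> A \<noteq> B \<Longrightarrow> A ** B = 0"
  using S by (simp add: orth_idempotents_def)

lemma orth_idempotents_mult: "A \<in> S \<Longrightarrow> B \<in> S \<Longrightarrow> A ** B = (if A = B then A else 0)"
  by (simp add: orth_idempotents_idem orth_idempotents_orth)

lemma orth_idempotents_sum_mult:
  assumes "A \<in> S" shows "\<Sum>S ** A = A"
proof -
  have "\<Sum>S ** A = (\<Sum>B\<in>S. if B = A then B else 0)"
    unfolding matrix_mult.sum_left
    by (rule sum.cong) (simp_all add: orth_idempotents_mult assms)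
  then show ?thesis using assms by (simp add: orth_idempotents_finite)
qed

lemma orth_idempotents_mult_sum:
  assumes "A \<in> S" shows "A ** \<Sum>S = A"
proof -
  have "A ** \<Sum>S = (\<Sum>B\<in>S. if A = B then A else 0)"
    unfolding matrix_mult.sum_right
    by (rule sum.cong) (simp_all add: orth_idempotents_mult assms)
  then show ?thesis using assms by (simp add: orth_idempotents_finite)
qed

lemma orth_idempotents_sum_transpose: "transpose (\<Sum>S) = \<Sum>S"
  by (simp add: linear_sum[OF linear_transpose] orth_idempotents_transpose)

end

section \<open>Splitting each idempotent into an orthogonal family\<close>

context
  fixes S :: "(real ^ 'o::finite ^ 'o) set" and T
  assumes S: "orth_idempotents S"
    and T: "\<And>A. A \<in> S \<Longrightarrow> orth_idempotents (T A)"
    and sum_T: "\<And>A. A \<in> S \<Longrightarrow> \<Sum>(T A) = A"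
begin

lemma refined_mult: "A \<in> S \<Longrightarrow> X \<in> T A \<Longrightarrow> A ** X = X"
  using orth_idempotents_sum_mult[OF T] sum_T by metis

lemma mult_refined: "A \<in> S \<Longrightarrow> X \<in> T A \<Longrightarrow> X ** A = X"
  using orth_idempotents_mult_sum[OF T] sum_T by metis

lemma refined_orth:
  assumes "A \<in> S" "B \<in> S" "A \<noteq> B" "X \<in> T A" "Y \<in> T B"
  shows "X ** Y = 0"
proof -
  have "X ** Y = X ** (A ** B) ** Y"
    using assms by (metis refined_mult mult_refined matrix_mul_assoc)
  also have "\<dots> = 0" using assms by (simp add: orth_idempotents_orth[OF S])
  finally show ?thesis .
qed

text \<open>A common member X would satisfy X = X ** X = 0.\<close>

lemma refined_disjoint: "A \<in> S \<Longrightarrow> B \<in> S \<Longrightarrow> A \<noteq> B \<Longrightarrow> T A \<inter> T B = {}"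
  using refined_orth orth_idempotents_idem[OF T] orth_idempotents_nonzero[OF T]
  by (metis disjoint_iff)

lemma sum_UN_refined: "(\<Sum>X\<in>(\<Union>A\<in>S. T A). h X) = (\<Sum>A\<in>S. \<Sum>X\<in>T A. h X)"
  by (rule sum.UNION_disjoint)
    (use orth_idempotents_finite[OF S] orth_idempotents_finite[OF T] refined_disjoint in auto)

lemma orth_idempotents_UN: "orth_idempotents (\<Union>A\<in>S. T A)"
  unfolding orth_idempotents_def
proof (intro conjI ballI impI)
  show "finite (\<Union>A\<in>S. T A)"
    using orth_idempotents_finite[OF S] orth_idempotents_finite[OF T] by blast
next
  fix X Y assume "X \<in> (\<Union>A\<in>S. T A)" "Y \<in> (\<Union>A\<in>S. T A)" "X \<noteq> Y"
  then show "X ** Y = 0" using refined_orth orth_idempotents_orth[OF T] by blast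
qed (use orth_idempotents_nonzero[OF T] orth_idempotents_transpose[OF T]
    orth_idempotents_idem[OF T] in blast)+

end

section \<open>Absorption by the projection onto a larger space\<close>

lemma orth_projection_matrix_fixes:
  assumes "orth_projection_matrix V A" "subspace V" "v \<in> V"
  shows "A *v v = v"
proof -
  have "v - A *v v \<in> V"
    using assms by (simp add: orth_projection_matrix_def subspace_diff)
  then have "orthogonal (v - A *v v) (v - A *v v)"
    using assms(1) by (simp add: orth_projection_matrix_def)
  then show ?thesis by (simp add: orthogonal_def)
qed

context
  fixes U V :: "(real ^ 'o::finite) set" and \<Q> \<R> :: "(real ^ 'o ^ 'o) set"
  assumes \<Q>: "orth_decomposition V \<Q>" and \<R>: "orth_decomposition U \<R>" and UV: "U \<subseteq> V"
begin

text \<open>The range of R lies in U, because \<open>\<Sum>\<R>\<close> fixes every R *v x and maps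
  into U; on V, which contains U, the projection \<open>\<Sum>\<Q>\<close> is the identity.\<close>

lemma sum_mult_subdecomposition:
  assumes "R \<in> \<R>" shows "\<Sum>\<Q> ** R = R"
proof -
  have "(\<Sum>\<Q> ** R) *v x = R *v x" for x
  proof -
    have "R *v x = \<Sum>\<R> *v (R *v x)"
      using \<R> assms
      by (simp add: orth_decomposition_iff orth_idempotents_sum_mult matrix_vector_mul_assoc)
    also have "\<dots> \<in> U"
      using \<R> by (simp add: orth_decomposition_iff orth_projection_matrix_def)
    finally have "\<Sum>\<Q> *v (R *v x) = R *v x"
      using \<Q> UV by (auto simp: orth_decomposition_iff intro!: orth_projection_matrix_fixes)
    then show ?thesis by (simp add: matrix_vector_mul_assoc)
  qed
  then show ?thesis by (simp add: matrix_eq)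
qed

lemma subdecomposition_mult_sum:
  assumes "R \<in> \<R>" shows "R ** \<Sum>\<Q> = R"
proof -
  have "transpose R = R" "transpose (\<Sum>\<Q>) = \<Sum>\<Q>"
    using \<Q> \<R> assms
    by (auto simp: orth_decomposition_iff orth_idempotents_transpose orth_idempotents_sum_transpose)
  then show ?thesis
    using sum_mult_subdecomposition[OF assms] by (metis matrix_transpose_mul)
qed

end

section \<open>Balance in relation to a single matrix\<close>

text \<open>P is an arbitrary matrix here, so that the notion also applies to
  \<open>P \<rhd> Q\<close> and to a possibly zero \<open>P \<turnstile> \<Q>\<close>.\<close>

definition balanced_for :: "real ^ 'o::finite ^ 'o \<Rightarrow> (real ^ 'o ^ 'o) set \<Rightarrow> bool" where
  "balanced_for P \<Q> \<longleftrightarrow>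
     (\<forall>Q\<in>\<Q>. Q ** P ** Q = efficiency P Q *\<^sub>R Q) \<and>
     (\<forall>Q1\<in>\<Q>. \<forall>Q2\<in>\<Q>. Q1 \<noteq> Q2 \<longrightarrow> Q1 ** P ** Q2 = 0)"

lemma balanced_forI:
  assumes "orth_idempotents \<Q>"
    and "\<And>Q. Q \<in> \<Q> \<Longrightarrow> Q ** P ** Q = c Q *\<^sub>R Q"
    and "\<And>Q1 Q2. Q1 \<in> \<Q> \<Longrightarrow> Q2 \<in> \<Q> \<Longrightarrow> Q1 \<noteq> Q2 \<Longrightarrow> Q1 ** P ** Q2 = 0"
  shows "balanced_for P \<Q>"
proof -
  have "efficiency P Q = c Q" if "Q \<in> \<Q>" for Q
    by (rule efficiency_eqI[OF orth_idempotents_nonzero[OF assms(1) that] assms(2)[OF that]])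
  then show ?thesis using assms(2,3) by (simp add: balanced_for_def)
qed

lemma structure_balanced_iff:
  "structure_balanced V \<Q> W \<P> \<longleftrightarrow>
     orth_decomposition W \<P> \<and> orth_decomposition V \<Q> \<and> V \<subseteq> W \<and> (\<forall>P\<in>\<P>. balanced_for P \<Q>)"
  (is "?L \<longleftrightarrow> ?R")
proof
  assume L: ?L
  show ?R
    using L structure_balanced_efficiency[OF L]
    unfolding structure_balanced_def balanced_for_def by blast
next
  assume ?R
  then show ?L unfolding structure_balanced_def balanced_for_def by blast
qed

section \<open>The pieces into which a single P is split\<close>

definition refine_part :: "real ^ 'o::finite ^ 'o \<Rightarrow> (real ^ 'o ^ 'o) set \<Rightarrow> (real ^ 'o ^ 'o) set" where
  "refine_part P \<Q> = ({P \<rhd> Q | Q. Q \<in> \<Q> \<and> efficiency P Q \<noteq> 0} \<union> {P \<turnstile> \<Q>}) - {0}"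

lemma set_refine_eq_UN: "\<P> \<rhd>\<^sub>S \<Q> = (\<Union>P\<in>\<P>. refine_part P \<Q>)"
  unfolding set_refine_def refine_part_def by blast

context
  fixes P :: "real ^ 'o::finite ^ 'o" and \<Q>
  assumes \<Q>: "orth_idempotents \<Q>" and bal: "balanced_for P \<Q>"
begin

lemma balanced_for_efficiency: "Q \<in> \<Q> \<Longrightarrow> Q ** P ** Q = efficiency P Q *\<^sub>R Q"
  using bal by (simp add: balanced_for_def)

lemma balanced_for_orth: "Q1 \<in> \<Q> \<Longrightarrow> Q2 \<in> \<Q> \<Longrightarrow> Q1 \<noteq> Q2 \<Longrightarrow> Q1 ** P ** Q2 = 0"
  using bal by (simp add: balanced_for_def)

lemma balanced_for_compress: "\<Sum>\<Q> ** P ** \<Sum>\<Q> = (\<Sum>Q\<in>\<Q>. efficiency P Q *\<^sub>R Q)"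
proof -
  have "\<Sum>\<Q> ** P ** \<Sum>\<Q> = (\<Sum>Q2\<in>\<Q>. \<Sum>Q1\<in>\<Q>. Q1 ** P ** Q2)"
    by (simp add: matrix_mult.sum_left matrix_mult.sum_right)
  also have "\<dots> = (\<Sum>Q2\<in>\<Q>. \<Sum>Q1\<in>\<Q>. if Q1 = Q2 then efficiency P Q2 *\<^sub>R Q2 else 0)"
    by (intro sum.cong refl) (simp add: balanced_for_efficiency balanced_for_orth)
  finally show ?thesis by (simp add: orth_idempotents_finite[OF \<Q>])
qed

text \<open>X and Y absorb \<open>\<Sum>\<Q>\<close>, so P may be replaced by its compression, which
  is a combination of members of \<open>\<Q>\<close>.\<close>

lemma balanced_for_expand:
  assumes "X ** \<Sum>\<Q> = X" "\<Sum>\<Q> ** Y = Y"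
  shows "X ** P ** Y = (\<Sum>Q\<in>\<Q>. efficiency P Q *\<^sub>R (X ** Q ** Y))"
proof -
  have "X ** P ** Y = X ** (\<Sum>\<Q> ** P ** \<Sum>\<Q>) ** Y"
    by (metis assms matrix_mul_assoc)
  then show ?thesis
    unfolding balanced_for_compress
    by (simp add: matrix_mult.sum_left matrix_mult.sum_right matrix_mult.scaleR_left matrix_mult.scaleR_right)
qed

lemma balanced_for_mult:
  assumes "Q \<in> \<Q>" "\<Sum>\<Q> ** Y = Y"
  shows "Q ** P ** Y = efficiency P Q *\<^sub>R (Q ** Y)"
proof -
  have "Q ** P ** Y = (\<Sum>Q'\<in>\<Q>. efficiency P Q' *\<^sub>R (Q ** Q' ** Y))"
    by (rule balanced_for_expand[OF orth_idempotents_mult_sum[OF \<Q> assms(1)] assms(2)])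
  also have "\<dots> = (\<Sum>Q'\<in>\<Q>. if Q = Q' then efficiency P Q *\<^sub>R (Q ** Y) else 0)"
    by (rule sum.cong) (simp_all add: orth_idempotents_mult[OF \<Q>] assms)
  finally show ?thesis using assms by (simp add: orth_idempotents_finite[OF \<Q>])
qed

lemma mult_balanced_for:
  assumes "Q \<in> \<Q>" "Y ** \<Sum>\<Q> = Y"
  shows "Y ** P ** Q = efficiency P Q *\<^sub>R (Y ** Q)"
proof -
  have "Y ** P ** Q = (\<Sum>Q'\<in>\<Q>. efficiency P Q' *\<^sub>R (Y ** (Q' ** Q)))"
    using balanced_for_expand[OF assms(2) orth_idempotents_sum_mult[OF \<Q> assms(1)]]
    by (simp add: matrix_mul_assoc)
  also have "\<dots> = (\<Sum>Q'\<in>\<Q>. if Q' = Q then efficiency P Q *\<^sub>R (Y ** Q) else 0)"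
    by (rule sum.cong) (simp_all add: orth_idempotents_mult[OF \<Q>] assms)
  finally show ?thesis using assms by (simp add: orth_idempotents_finite[OF \<Q>])
qed

text \<open>The restriction to nonzero efficiency factors is immaterial because \<open>inverse 0 = 0\<close>.\<close>

lemma mat_residual_eq: "P \<turnstile> \<Q> = P - (\<Sum>Q\<in>\<Q>. P \<rhd> Q)"
proof -
  have "(\<Sum>Q\<in>{Q \<in> \<Q>. efficiency P Q \<noteq> 0}. P \<rhd> Q) = (\<Sum>Q\<in>\<Q>. P \<rhd> Q)"
    by (rule sum.mono_neutral_left)
      (auto simp: orth_idempotents_finite[OF \<Q>] mat_refine_def)
  then show ?thesis by (simp add: mat_residual_def)
qed

text \<open>Compressing P ** Q ** P by Q returns Q scaled by the square of the efficiency
  factor.\<close>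

lemma mat_refine_nonzero:
  assumes "Q \<in> \<Q>" "efficiency P Q \<noteq> 0"
  shows "P \<rhd> Q \<noteq> 0"
proof
  assume "P \<rhd> Q = 0"
  then have "P ** Q ** P = 0" using assms by (simp add: mat_refine_def)
  moreover have "Q ** (P ** Q ** P) ** Q = (Q ** P ** Q) ** P ** Q"
    by (simp add: matrix_mul_assoc)
  ultimately have "efficiency P Q *\<^sub>R (efficiency P Q *\<^sub>R Q) = 0"
    using assms
    by (simp add: balanced_for_efficiency matrix_mult.scaleR_left del: scaleR_scaleR)
  then show False using assms orth_idempotents_nonzero[OF \<Q>] by simp
qed

context
  assumes P_transpose: "transpose P = P" and P_idem: "P ** P = P"
begin

lemma transpose_mat_refine: "Q \<in> \<Q> \<Longrightarrow> transpose (P \<rhd> Q) = P \<rhd> Q"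
  by (simp add: mat_refine_def transpose_scalar matrix_transpose_mul P_transpose
      orth_idempotents_transpose[OF \<Q>] matrix_mul_assoc)

text \<open>Idempotence of P leaves the compression Q1 ** P ** Q2 in the middle, and one normalising
  inverse cancels the resulting factor. With efficiency factor 0 all terms vanish, since
  \<open>inverse 0 = 0\<close>.\<close>

lemma mat_refine_mult:
  assumes "Q1 \<in> \<Q>" "Q2 \<in> \<Q>"
  shows "(P \<rhd> Q1) ** (P \<rhd> Q2) = (if Q1 = Q2 then P \<rhd> Q1 else 0)"
proof -
  have "P ** Q1 ** P ** (P ** Q2 ** P) = P ** (Q1 ** (P ** P) ** Q2) ** P"
    by (simp add: matrix_mul_assoc)
  also have "\<dots> = (if Q1 = Q2 then efficiency P Q1 *\<^sub>R (P ** Q1 ** P) else 0)"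
    using assms by (simp add: P_idem balanced_for_efficiency balanced_for_orth
        matrix_mult.scaleR_left matrix_mult.scaleR_right)
  finally show ?thesis
    by (cases "Q1 = Q2"; cases "efficiency P Q2 = 0")
      (simp_all add: mat_refine_def matrix_mult.scaleR_left matrix_mult.scaleR_right)
qed

lemma mat_refine_mult_idem: "(P \<rhd> Q) ** P = P \<rhd> Q"
proof -
  have "P ** Q ** P ** P = P ** Q ** (P ** P)" by (simp only: matrix_mul_assoc)
  then show ?thesis by (simp add: mat_refine_def P_idem matrix_mult.scaleR_left)
qed

lemma idem_mult_mat_refine: "P ** (P \<rhd> Q) = P \<rhd> Q"
  by (simp add: mat_refine_def P_idem matrix_mult.scaleR_right matrix_mul_assoc)

lemma mat_residual_mult_refine:
  assumes "Q \<in> \<Q>" shows "(P \<turnstile> \<Q>) ** (P \<rhd> Q) = 0"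
  using assms by (simp add: mat_residual_eq matrix_mult.diff_left matrix_mult.sum_left
      idem_mult_mat_refine mat_refine_mult orth_idempotents_finite[OF \<Q>] cong: sum.cong)

lemma mat_refine_mult_residual:
  assumes "Q \<in> \<Q>" shows "(P \<rhd> Q) ** (P \<turnstile> \<Q>) = 0"
  using assms by (simp add: mat_residual_eq matrix_mult.diff_right matrix_mult.sum_right
      mat_refine_mult_idem mat_refine_mult orth_idempotents_finite[OF \<Q>] cong: sum.cong)

lemma transpose_mat_residual: "transpose (P \<turnstile> \<Q>) = P \<turnstile> \<Q>"
  by (simp add: mat_residual_eq linear_diff[OF linear_transpose] linear_sum[OF linear_transpose]
      P_transpose transpose_mat_refine)

lemma mat_residual_idem: "(P \<turnstile> \<Q>) ** (P \<turnstile> \<Q>) = P \<turnstile> \<Q>"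
proof -
  \<comment> \<open>Only the right factor is unfolded; the left residual then annihilates every
    \<open>P \<rhd> Q\<close>.\<close>
  have "(P \<turnstile> \<Q>) ** (P \<turnstile> \<Q>) = (P \<turnstile> \<Q>) ** P - (\<Sum>Q\<in>\<Q>. (P \<turnstile> \<Q>) ** (P \<rhd> Q))"
    by (subst (2) mat_residual_eq) (simp add: matrix_mult.diff_right matrix_mult.sum_right)
  also have "\<dots> = (P \<turnstile> \<Q>) ** P" by (simp add: mat_residual_mult_refine)
  also have "\<dots> = P \<turnstile> \<Q>"
    by (simp add: mat_residual_eq matrix_mult.diff_left matrix_mult.sum_left P_idem
        mat_refine_mult_idem)
  finally show ?thesis .
qed

lemma orth_idempotents_refine_part: "orth_idempotents (refine_part P \<Q>)"
proof -
  have "finite (refine_part P \<Q>)"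
    using orth_idempotents_finite[OF \<Q>] by (simp add: refine_part_def)
  then show ?thesis
    unfolding orth_idempotents_def
    by (auto simp: refine_part_def transpose_mat_refine transpose_mat_residual mat_refine_mult
        mat_residual_idem mat_residual_mult_refine mat_refine_mult_residual)
qed

text \<open>The sum defining the residual is indexed by Q, whereas this one runs over a set of
  matrices. They match once the \<open>P \<rhd> Q\<close> with nonzero factor are pairwise distinct
  and differ from a nonzero residual.\<close>

lemma sum_refine_part: "\<Sum>(refine_part P \<Q>) = P"
proof -
  define T where "T = {Q \<in> \<Q>. efficiency P Q \<noteq> 0}"
  have "inj_on (\<lambda>Q. P \<rhd> Q) T"
  proof (rule inj_onI, rule ccontr)
    fix Q1 Q2 assume "Q1 \<in> T" "Q2 \<in> T" "P \<rhd> Q1 = P \<rhd> Q2" "Q1 \<noteq> Q2"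
    then show False
      using mat_refine_mult[of Q1 Q1] mat_refine_mult[of Q1 Q2] mat_refine_nonzero[of Q1]
      by (simp add: T_def)
  qed
  then have sum_image: "\<Sum>((\<lambda>Q. P \<rhd> Q) ` T) = P - P \<turnstile> \<Q>"
    by (simp add: sum.reindex mat_residual_def T_def)
  have part: "refine_part P \<Q> = (\<lambda>Q. P \<rhd> Q) ` T \<union> ({P \<turnstile> \<Q>} - {0})"
    using mat_refine_nonzero by (auto simp: refine_part_def T_def)
  \<comment> \<open>A residual equal to some \<open>P \<rhd> Q\<close> would have square 0 while
    being idempotent, hence would be 0.\<close>
  have "(\<lambda>Q. P \<rhd> Q) ` T \<inter> ({P \<turnstile> \<Q>} - {0}) = {}"
    using mat_residual_idem mat_residual_mult_refine by (fastforce simp: T_def)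
  then have "\<Sum>(refine_part P \<Q>) = (P - P \<turnstile> \<Q>) + \<Sum>({P \<turnstile> \<Q>} - {0})"
    unfolding part using orth_idempotents_finite[OF \<Q>]
    by (subst sum.union_disjoint) (simp_all add: sum_image, simp add: T_def)
  also have "\<Sum>({P \<turnstile> \<Q>} - {0}) = P \<turnstile> \<Q>"
    by (cases "P \<turnstile> \<Q> = 0") simp_all
  finally show ?thesis by simp
qed

end

end

section \<open>Refinement of a decomposition\<close>

context
  fixes \<P> \<Q> :: "(real ^ 'o::finite ^ 'o) set"
  assumes \<P>: "orth_idempotents \<P>" and \<Q>: "orth_idempotents \<Q>"
    and bal: "\<And>P. P \<in> \<P> \<Longrightarrow> balanced_for P \<Q>"
begin

lemma refine_parts:
  assumes "P \<in> \<P>"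
  shows "orth_idempotents (refine_part P \<Q>)" "\<Sum>(refine_part P \<Q>) = P"
  using orth_idempotents_refine_part[OF \<Q> bal[OF assms]] sum_refine_part[OF \<Q> bal[OF assms]]
    orth_idempotents_transpose[OF \<P> assms] orth_idempotents_idem[OF \<P> assms] by blast+

lemma orth_idempotents_set_refine: "orth_idempotents (\<P> \<rhd>\<^sub>S \<Q>)"
  unfolding set_refine_eq_UN by (rule orth_idempotents_UN[OF \<P> refine_parts])

lemma sum_set_refine: "(\<Sum>X\<in>\<P> \<rhd>\<^sub>S \<Q>. h X) = (\<Sum>P\<in>\<P>. \<Sum>X\<in>refine_part P \<Q>. h X)"
  unfolding set_refine_eq_UN by (rule sum_UN_refined[OF \<P> refine_parts])

end

text \<open>The pieces of each P sum to P, so the total, and with it the projection onto W, is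
  unchanged.\<close>

lemma orth_decomposition_set_refine:
  assumes "structure_balanced V \<Q> W \<P>"
  shows "orth_decomposition W (\<P> \<rhd>\<^sub>S \<Q>)"
proof -
  have *: "orth_idempotents \<P>" "orth_idempotents \<Q>" "\<And>P. P \<in> \<P> \<Longrightarrow> balanced_for P \<Q>"
    and W: "subspace W" "orth_projection_matrix W (\<Sum>\<P>)"
    using assms by (auto simp: structure_balanced_iff orth_decomposition_iff)
  have "\<Sum>(\<P> \<rhd>\<^sub>S \<Q>) = \<Sum>\<P>"
    using sum_set_refine[OF *, of "\<lambda>X. X"] refine_parts(2)[OF *] by simp
  then show ?thesis
    using W orth_idempotents_set_refine[OF *] by (simp add: orth_decomposition_iff)
qed

section \<open>Chains of balanced decompositions\<close>

text \<open>The inclusion of subspaces is represented by the two absorption hypotheses, as provided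
  by \<open>sum_mult_subdecomposition\<close> and \<open>subdecomposition_mult_sum\<close>.\<close>

context
  fixes \<P> \<Q> \<R> :: "(real ^ 'o::finite ^ 'o) set"
  assumes \<P>: "orth_idempotents \<P>" and \<Q>: "orth_idempotents \<Q>" and \<R>: "orth_idempotents \<R>"
    and PQ: "\<And>P. P \<in> \<P> \<Longrightarrow> balanced_for P \<Q>"
    and QR: "\<And>Q. Q \<in> \<Q> \<Longrightarrow> balanced_for Q \<R>"
    and absorb_left: "\<And>R. R \<in> \<R> \<Longrightarrow> \<Sum>\<Q> ** R = R"
    and absorb_right: "\<And>R. R \<in> \<R> \<Longrightarrow> R ** \<Sum>\<Q> = R"
begin

text \<open>P is expanded through \<open>\<Q>\<close>, and balance of \<open>\<R>\<close> in
  relation to each Q evaluates the terms. The matrix product of the efficiency matrices appears as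
  the resulting coefficient.\<close>

lemma chain_compress:
  assumes "P \<in> \<P>" "R1 \<in> \<R>" "R2 \<in> \<R>"
  shows "R1 ** P ** R2 =
    (if R1 = R2 then (\<Sum>Q\<in>\<Q>. efficiency P Q * efficiency Q R1) *\<^sub>R R1 else 0)"
proof -
  have "R1 ** P ** R2 = (\<Sum>Q\<in>\<Q>. efficiency P Q *\<^sub>R (R1 ** Q ** R2))"
    using assms by (intro balanced_for_expand[OF \<Q> PQ]) (simp_all add: absorb_left absorb_right)
  also have "\<dots> = (\<Sum>Q\<in>\<Q>. if R1 = R2 then (efficiency P Q * efficiency Q R1) *\<^sub>R R1 else 0)"
    using assms by (intro sum.cong refl)
      (simp add: balanced_for_efficiency[OF \<R> QR] balanced_for_orth[OF \<R> QR])
  finally show ?thesis by (simp add: scaleR_sum_left)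
qed

lemma chain_balanced_for: "P \<in> \<P> \<Longrightarrow> balanced_for P \<R>"
  by (rule balanced_forI[OF \<R>, where c = "\<lambda>R. \<Sum>Q\<in>\<Q>. efficiency P Q * efficiency Q R"])
    (simp_all add: chain_compress)

lemma chain_efficiency:
  assumes "P \<in> \<P>" "R \<in> \<R>"
  shows "efficiency P R = (\<Sum>Q\<in>\<Q>. efficiency P Q * efficiency Q R)"
  using assms by (intro efficiency_eqI) (simp_all add: chain_compress orth_idempotents_nonzero[OF \<R>])

lemma chain_left:
  assumes "P \<in> \<P>" "Q \<in> \<Q>" "R \<in> \<R>"
  shows "Q ** P ** R = efficiency P Q *\<^sub>R (Q ** R)"
  using assms by (intro balanced_for_mult[OF \<Q> PQ]) (simp_all add: absorb_left)

lemma chain_right: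
  assumes "P \<in> \<P>" "Q \<in> \<Q>" "R \<in> \<R>"
  shows "R ** P ** Q = efficiency P Q *\<^sub>R (R ** Q)"
  using assms by (intro mult_balanced_for[OF \<Q> PQ]) (simp_all add: absorb_right)

section \<open>Balance in relation to the refinement of \<open>\<P>\<close> by
  \<open>\<Q>\<close>\<close>

text \<open>Removing P on either side of Q yields one efficiency factor each; the normalisation of
  \<open>P \<rhd> Q\<close> cancels one of the two. If the factor is 0, both sides are 0.\<close>

lemma compress_refine:
  assumes "P \<in> \<P>" "Q \<in> \<Q>" "R1 \<in> \<R>" "R2 \<in> \<R>"
  shows "R1 ** (P \<rhd> Q) ** R2 = efficiency P Q *\<^sub>R (R1 ** Q ** R2)"
proof -
  have "R1 ** (P ** Q ** P) ** R2 = (R1 ** P ** Q) ** P ** R2"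
    by (simp add: matrix_mul_assoc)
  also have "\<dots> = efficiency P Q *\<^sub>R (R1 ** (Q ** P ** R2))"
    using assms by (simp add: chain_right matrix_mult.scaleR_left matrix_mul_assoc)
  also have "\<dots> = (efficiency P Q * efficiency P Q) *\<^sub>R (R1 ** Q ** R2)"
    using assms by (simp add: chain_left matrix_mult.scaleR_right matrix_mul_assoc)
  finally show ?thesis
    by (cases "efficiency P Q = 0")
      (simp_all add: mat_refine_def matrix_mult.scaleR_left matrix_mult.scaleR_right)
qed

text \<open>Between members of \<open>\<R>\<close>, both P and the sum of all
  \<open>P \<rhd> Q\<close> reduce to the same combination of the R1 ** Q ** R2.\<close>

lemma compress_residual:
  assumes "P \<in> \<P>" "R1 \<in> \<R>" "R2 \<in> \<R>"
  shows "R1 ** (P \<turnstile> \<Q>) ** R2 = 0"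
proof -
  have "R1 ** (P \<turnstile> \<Q>) ** R2 = R1 ** P ** R2 - (\<Sum>Q\<in>\<Q>. R1 ** (P \<rhd> Q) ** R2)"
    using assms by (simp add: mat_residual_eq[OF \<Q> PQ] matrix_mult.diff_left
        matrix_mult.diff_right matrix_mult.sum_left matrix_mult.sum_right)
  also have "(\<Sum>Q\<in>\<Q>. R1 ** (P \<rhd> Q) ** R2) = (\<Sum>Q\<in>\<Q>. efficiency P Q *\<^sub>R (R1 ** Q ** R2))"
    using assms by (simp add: compress_refine)
  also have "\<dots> = R1 ** P ** R2"
    using assms
    by (intro balanced_for_expand[OF \<Q> PQ, symmetric]) (simp_all add: absorb_left absorb_right)
  finally show ?thesis by simp
qed

lemma efficiency_refine_left:
  assumes "P \<in> \<P>" "Q \<in> \<Q>" "R \<in> \<R>"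
  shows "efficiency (P \<rhd> Q) R = efficiency P Q * efficiency Q R"
  using assms by (intro efficiency_eqI)
    (simp_all add: compress_refine balanced_for_efficiency[OF \<R> QR] orth_idempotents_nonzero[OF \<R>])

lemma efficiency_residual_left:
  assumes "P \<in> \<P>" "R \<in> \<R>"
  shows "efficiency (P \<turnstile> \<Q>) R = 0"
  using assms by (intro efficiency_eqI)
    (simp_all add: compress_residual orth_idempotents_nonzero[OF \<R>])

lemma balanced_for_refine_left:
  assumes "P \<in> \<P>" "Q \<in> \<Q>"
  shows "balanced_for (P \<rhd> Q) \<R>"
  using assms by (intro balanced_forI[OF \<R>, where c = "\<lambda>R. efficiency P Q * efficiency Q R"])
    (simp_all add: compress_refine balanced_for_efficiency[OF \<R> QR] balanced_for_orth[OF \<R> QR])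

lemma balanced_for_residual_left: "P \<in> \<P> \<Longrightarrow> balanced_for (P \<turnstile> \<Q>) \<R>"
  by (rule balanced_forI[OF \<R>, where c = "\<lambda>_. 0"]) (simp_all add: compress_residual)

lemma balanced_for_set_refine_left: "X \<in> \<P> \<rhd>\<^sub>S \<Q> \<Longrightarrow> balanced_for X \<R>"
  using balanced_for_refine_left balanced_for_residual_left by (auto simp: set_refine_def)

section \<open>Balance of the refinement of \<open>\<Q>\<close> by \<open>\<R>\<close>\<close>

text \<open>Since X = X ** Q1 and Y = Q2 ** Y, everything reduces to Q1 ** P ** Q2, which balance
  evaluates.\<close>

lemma compress_refine_part:
  assumes "P \<in> \<P>" "Q1 \<in> \<Q>" "Q2 \<in> \<Q>" "X \<in> refine_part Q1 \<R>" "Y \<in> refine_part Q2 \<R>"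
  shows "X ** P ** Y = (if X = Y then efficiency P Q1 *\<^sub>R X else 0)"
proof -
  have parts: "orth_idempotents (refine_part Q \<R>)" "\<Sum>(refine_part Q \<R>) = Q" if "Q \<in> \<Q>" for Q
    using refine_parts[OF \<Q> \<R> QR] that by blast+
  note mult = refined_mult[OF \<Q> parts] mult_refined[OF \<Q> parts]
  have *: "X ** P ** Y = X ** (Q1 ** P ** Q2) ** Y"
    using assms mult by (metis matrix_mul_assoc)
  show ?thesis
  proof (cases "Q1 = Q2")
    case True
    then have "X ** P ** Y = efficiency P Q1 *\<^sub>R (X ** Q1 ** Y)"
      unfolding * using assms
      by (simp add: balanced_for_efficiency[OF \<Q> PQ] matrix_mult.scaleR_left matrix_mult.scaleR_right)
    also have "X ** Q1 ** Y = (if X = Y then X else 0)"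
      using assms True mult orth_idempotents_mult[OF parts(1)] by metis
    finally show ?thesis by simp
  next
    case False
    \<comment> \<open>The claim distinguishes cases by X and Y, not by Q1 and Q2; pieces of
      different members never coincide.\<close>
    moreover from this have "X \<noteq> Y"
      using refined_disjoint[OF \<Q> parts] assms by blast
    ultimately show ?thesis
      unfolding * using assms by (simp add: balanced_for_orth[OF \<Q> PQ])
  qed
qed

lemma efficiency_refine_part:
  assumes "P \<in> \<P>" "Q \<in> \<Q>" "X \<in> refine_part Q \<R>"
  shows "efficiency P X = efficiency P Q"
  using assms by (intro efficiency_eqI) (simp_all add: compress_refine_part, simp add: refine_part_def)

lemma efficiency_refine_right:
  assumes "P \<in> \<P>" "Q \<in> \<Q>" "R \<in> \<R>" "efficiency Q R \<noteq> 0"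
  shows "efficiency P (Q \<rhd> R) = efficiency P Q"
  using assms mat_refine_nonzero[OF \<R> QR]
  by (intro efficiency_refine_part) (auto simp: refine_part_def)

text \<open>For a zero residual every scalar satisfies the equation defining
  \<open>efficiency\<close>, so its value would be unspecified.\<close>

lemma efficiency_residual_right:
  assumes "P \<in> \<P>" "Q \<in> \<Q>" "Q \<turnstile> \<R> \<noteq> 0"
  shows "efficiency P (Q \<turnstile> \<R>) = efficiency P Q"
  using assms by (intro efficiency_refine_part) (auto simp: refine_part_def)

lemma balanced_for_set_refine_right:
  assumes "P \<in> \<P>"
  shows "balanced_for P (\<Q> \<rhd>\<^sub>S \<R>)"
proof (rule balanced_forI[OF orth_idempotents_set_refine[OF \<Q> \<R> QR]])
  show "X ** P ** X = efficiency P X *\<^sub>R X" if "X \<in> \<Q> \<rhd>\<^sub>S \<R>" for X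
    using that assms by (auto simp: set_refine_eq_UN compress_refine_part efficiency_refine_part)
  show "X ** P ** Y = 0" if "X \<in> \<Q> \<rhd>\<^sub>S \<R>" "Y \<in> \<Q> \<rhd>\<^sub>S \<R>" "X \<noteq> Y" for X Y
    using that assms by (auto simp: set_refine_eq_UN compress_refine_part)
qed

section \<open>Associativity of refinement\<close>

text \<open>The inner copies of P contribute the squared factor \<open>efficiency P Q\<close>, which
  cancels both normalisations in \<open>P \<rhd> Q\<close>. Avoiding
  \<open>P \<rhd> (Q \<rhd> R)\<close> on the right keeps the identity valid when
  \<open>efficiency Q R = 0\<close>, so it can be summed over all of \<open>\<R>\<close>.\<close>

lemma mat_refine_assoc_scaled:
  assumes "P \<in> \<P>" "Q \<in> \<Q>" "R \<in> \<R>" "efficiency P Q \<noteq> 0"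
  shows "(P \<rhd> Q) \<rhd> R = inverse (efficiency P Q) *\<^sub>R (P ** (Q \<rhd> R) ** P)"
proof -
  have "P ** Q ** P ** R ** (P ** Q ** P) = P ** ((Q ** P ** R) ** P ** Q) ** P"
    by (simp add: matrix_mul_assoc)
  also have "(Q ** P ** R) ** P ** Q = efficiency P Q *\<^sub>R (Q ** (R ** P ** Q))"
    using assms by (simp add: chain_left matrix_mult.scaleR_left matrix_mul_assoc)
  also have "\<dots> = (efficiency P Q * efficiency P Q) *\<^sub>R (Q ** R ** Q)"
    using assms by (simp add: chain_right matrix_mult.scaleR_right matrix_mul_assoc)
  finally have "P ** Q ** P ** R ** (P ** Q ** P) =
      (efficiency P Q * efficiency P Q) *\<^sub>R (P ** (Q ** R ** Q) ** P)"
    by (simp add: matrix_mult.scaleR_left matrix_mult.scaleR_right)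
  moreover have "inverse (efficiency P Q) * (inverse (efficiency P Q) *
      (efficiency P Q * efficiency P Q)) = 1"
    using assms by (simp add: field_simps)
  ultimately have "(P \<rhd> Q) ** R ** (P \<rhd> Q) = P ** (Q ** R ** Q) ** P"
    by (simp add: mat_refine_def[of P Q] matrix_mult.scaleR_left matrix_mult.scaleR_right)
  then show ?thesis
    using assms by (simp add: mat_refine_def[of "P \<rhd> Q"] efficiency_refine_left
        mat_refine_def[of Q] matrix_mult.scaleR_left matrix_mult.scaleR_right)
qed

lemma mat_refine_assoc:
  assumes "P \<in> \<P>" "Q \<in> \<Q>" "R \<in> \<R>" "efficiency P Q \<noteq> 0" "efficiency Q R \<noteq> 0"
  shows "P \<rhd> (Q \<rhd> R) = (P \<rhd> Q) \<rhd> R"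
  using assms by (simp add: mat_refine_assoc_scaled mat_refine_def[of P "Q \<rhd> R"] efficiency_refine_right)

text \<open>Obtained by summing the preceding scaled identity over \<open>\<R>\<close>. It covers
  \<open>Q \<turnstile> \<R> = 0\<close> as well, and so shows that the left side is then 0.\<close>

lemma mat_refine_residual_scaled:
  assumes "P \<in> \<P>" "Q \<in> \<Q>" "efficiency P Q \<noteq> 0"
  shows "(P \<rhd> Q) \<turnstile> \<R> = inverse (efficiency P Q) *\<^sub>R (P ** (Q \<turnstile> \<R>) ** P)"
proof -
  have "(P \<rhd> Q) \<turnstile> \<R> = P \<rhd> Q - (\<Sum>R\<in>\<R>. (P \<rhd> Q) \<rhd> R)"
    using assms by (intro mat_residual_eq[OF \<R> balanced_for_refine_left])
  also have "\<dots> = P \<rhd> Q - (\<Sum>R\<in>\<R>. inverse (efficiency P Q) *\<^sub>R (P ** (Q \<rhd> R) ** P))"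
    using assms by (simp add: mat_refine_assoc_scaled)
  also have "\<dots> = inverse (efficiency P Q) *\<^sub>R
      (P ** Q ** P - (\<Sum>R\<in>\<R>. P ** (Q \<rhd> R) ** P))"
    by (simp add: scaleR_diff_right scaleR_sum_right mat_refine_def[of P Q])
  also have "P ** Q ** P - (\<Sum>R\<in>\<R>. P ** (Q \<rhd> R) ** P) = P ** (Q \<turnstile> \<R>) ** P"
    using assms by (simp add: mat_residual_eq[OF \<R> QR] matrix_mult.diff_left
        matrix_mult.diff_right matrix_mult.sum_left matrix_mult.sum_right)
  finally show ?thesis .
qed

lemma mat_refine_residual:
  assumes "P \<in> \<P>" "Q \<in> \<Q>" "efficiency P Q \<noteq> 0" "Q \<turnstile> \<R> \<noteq> 0"
  shows "P \<rhd> (Q \<turnstile> \<R>) = (P \<rhd> Q) \<turnstile> \<R>"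
  using assms
  by (simp add: mat_refine_residual_scaled mat_refine_def[of P "Q \<turnstile> \<R>"] efficiency_residual_right)

text \<open>All efficiency factors of \<open>P \<turnstile> \<Q>\<close> are 0, so nothing is
  subtracted.\<close>

lemma mat_residual_residual:
  assumes "P \<in> \<P>" shows "(P \<turnstile> \<Q>) \<turnstile> \<R> = P \<turnstile> \<Q>"
  using assms by (simp add: mat_residual_eq[OF \<R> balanced_for_residual_left] mat_refine_def
      efficiency_residual_left)

text \<open>All pieces X of Q share the efficiency factor of Q and sum to Q, so by linearity the
  \<open>P \<rhd> X\<close> sum to \<open>P \<rhd> Q\<close>.\<close>

lemma mat_residual_set_refine:
  assumes "P \<in> \<P>" shows "P \<turnstile> (\<Q> \<rhd>\<^sub>S \<R>) = P \<turnstile> \<Q>"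
proof -
  have "(\<Sum>X\<in>refine_part Q \<R>. P \<rhd> X) = P \<rhd> Q" if "Q \<in> \<Q>" for Q
  proof -
    have "(\<Sum>X\<in>refine_part Q \<R>. P \<rhd> X) =
        inverse (efficiency P Q) *\<^sub>R (P ** \<Sum>(refine_part Q \<R>) ** P)"
      using assms that by (simp add: mat_refine_def efficiency_refine_part scaleR_sum_right
          matrix_mult.sum_left matrix_mult.sum_right)
    then show ?thesis
      using that by (simp add: refine_parts(2)[OF \<Q> \<R> QR] mat_refine_def)
  qed
  then have "(\<Sum>X\<in>\<Q> \<rhd>\<^sub>S \<R>. P \<rhd> X) = (\<Sum>Q\<in>\<Q>. P \<rhd> Q)"
    by (simp add: sum_set_refine[OF \<Q> \<R> QR])
  then show ?thesis
    using assms mat_residual_eq[OF orth_idempotents_set_refine[OF \<Q> \<R> QR]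
        balanced_for_set_refine_right[OF assms]] mat_residual_eq[OF \<Q> PQ] by simp
qed

lemma set_refine_set_refine_left:
  "(\<P> \<rhd>\<^sub>S \<Q>) \<rhd>\<^sub>S \<R> =
     ({(P \<rhd> Q) \<rhd> R | P Q R. P \<in> \<P> \<and> Q \<in> \<Q> \<and> R \<in> \<R> \<and>
          efficiency P Q \<noteq> 0 \<and> efficiency Q R \<noteq> 0} \<union>
      {(P \<rhd> Q) \<turnstile> \<R> | P Q. P \<in> \<P> \<and> Q \<in> \<Q> \<and> efficiency P Q \<noteq> 0} \<union>
      {P \<turnstile> \<Q> | P. P \<in> \<P>}) - {0}" (is "?L = ?R")
proof (intro equalityI subsetI)
  fix Z assume "Z \<in> ?L"
  then have "Z \<noteq> 0" and "(\<exists>X\<in>\<P> \<rhd>\<^sub>S \<Q>. \<exists>R\<in>\<R>. efficiency X R \<noteq> 0 \<and> Z = X \<rhd> R) \<or>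
      (\<exists>X\<in>\<P> \<rhd>\<^sub>S \<Q>. Z = X \<turnstile> \<R>)"
    unfolding set_refine_def[of "\<P> \<rhd>\<^sub>S \<Q>"] by blast+
  then show "Z \<in> ?R"
  proof (elim disjE bexE conjE)
    fix X R assume *: "X \<in> \<P> \<rhd>\<^sub>S \<Q>" "R \<in> \<R>" "efficiency X R \<noteq> 0" "Z = X \<rhd> R"
    then obtain P Q where "P \<in> \<P>" "Q \<in> \<Q>" "efficiency P Q \<noteq> 0" "X = P \<rhd> Q"
      by (auto simp: set_refine_def efficiency_residual_left)
    moreover from this have "efficiency Q R \<noteq> 0" using * by (simp add: efficiency_refine_left)
    ultimately show ?thesis using * \<open>Z \<noteq> 0\<close> by blast
  next
    fix X assume *: "X \<in> \<P> \<rhd>\<^sub>S \<Q>" "Z = X \<turnstile> \<R>"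
    then consider P Q where "P \<in> \<P>" "Q \<in> \<Q>" "efficiency P Q \<noteq> 0" "X = P \<rhd> Q"
      | P where "P \<in> \<P>" "X = P \<turnstile> \<Q>"
      by (auto simp: set_refine_def)
    then show ?thesis using * \<open>Z \<noteq> 0\<close> by cases (auto simp: mat_residual_residual)
  qed
next
  fix Z assume "Z \<in> ?R"
  then have "Z \<noteq> 0" by blast
  \<comment> \<open>Membership requires \<open>P \<rhd> Q\<close> to survive the removal of zero
    matrices.\<close>
  have refine: "P \<rhd> Q \<in> \<P> \<rhd>\<^sub>S \<Q>" if "P \<in> \<P>" "Q \<in> \<Q>" "efficiency P Q \<noteq> 0" for P Q
    using that mat_refine_nonzero[OF \<Q> PQ] by (auto simp: set_refine_def)
  from \<open>Z \<in> ?R\<close> consider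
      P Q R where "P \<in> \<P>" "Q \<in> \<Q>" "R \<in> \<R>" "efficiency P Q \<noteq> 0" "efficiency Q R \<noteq> 0"
        "Z = (P \<rhd> Q) \<rhd> R"
    | P Q where "P \<in> \<P>" "Q \<in> \<Q>" "efficiency P Q \<noteq> 0" "Z = (P \<rhd> Q) \<turnstile> \<R>"
    | P where "P \<in> \<P>" "Z = P \<turnstile> \<Q>"
    by blast
  then show "Z \<in> ?L"
  proof cases
    case 1
    then have "efficiency (P \<rhd> Q) R \<noteq> 0" by (simp add: efficiency_refine_left)
    then show ?thesis
      using 1 refine \<open>Z \<noteq> 0\<close> unfolding set_refine_def[of "\<P> \<rhd>\<^sub>S \<Q>"] by blast
  next
    case 2
    then show ?thesis
      using refine \<open>Z \<noteq> 0\<close> unfolding set_refine_def[of "\<P> \<rhd>\<^sub>S \<Q>"] by blast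
  next
    case 3
    \<comment> \<open>A nonzero residual of P belongs to the first refinement and is its own
      residual with respect to \<open>\<R>\<close>.\<close>
    then have "Z \<in> \<P> \<rhd>\<^sub>S \<Q>" "Z = Z \<turnstile> \<R>"
      using \<open>Z \<noteq> 0\<close> by (auto simp: set_refine_def mat_residual_residual)
    then show ?thesis
      using \<open>Z \<noteq> 0\<close> unfolding set_refine_def[of "\<P> \<rhd>\<^sub>S \<Q>"] by blast
  qed
qed

lemma set_refine_set_refine_right:
  "\<P> \<rhd>\<^sub>S (\<Q> \<rhd>\<^sub>S \<R>) =
     ({(P \<rhd> Q) \<rhd> R | P Q R. P \<in> \<P> \<and> Q \<in> \<Q> \<and> R \<in> \<R> \<and>
          efficiency P Q \<noteq> 0 \<and> efficiency Q R \<noteq> 0} \<union>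
      {(P \<rhd> Q) \<turnstile> \<R> | P Q. P \<in> \<P> \<and> Q \<in> \<Q> \<and> efficiency P Q \<noteq> 0} \<union>
      {P \<turnstile> \<Q> | P. P \<in> \<P>}) - {0}" (is "?L = ?R")
proof (intro equalityI subsetI)
  fix Z assume "Z \<in> ?L"
  then have "Z \<noteq> 0" and "(\<exists>P\<in>\<P>. \<exists>X\<in>\<Q> \<rhd>\<^sub>S \<R>. efficiency P X \<noteq> 0 \<and> Z = P \<rhd> X) \<or>
      (\<exists>P\<in>\<P>. Z = P \<turnstile> (\<Q> \<rhd>\<^sub>S \<R>))"
    unfolding set_refine_def[of \<P>] by blast+
  then show "Z \<in> ?R"
  proof (elim disjE bexE conjE)
    fix P X assume *: "P \<in> \<P>" "X \<in> \<Q> \<rhd>\<^sub>S \<R>" "efficiency P X \<noteq> 0" "Z = P \<rhd> X"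
    then consider Q R where "Q \<in> \<Q>" "R \<in> \<R>" "efficiency Q R \<noteq> 0" "X = Q \<rhd> R"
      | Q where "Q \<in> \<Q>" "X = Q \<turnstile> \<R>" "Q \<turnstile> \<R> \<noteq> 0"
      by (auto simp: set_refine_def)
    then show ?thesis
    proof cases
      case 1
      then have "efficiency P Q \<noteq> 0" using * by (simp add: efficiency_refine_right)
      moreover from this have "Z = (P \<rhd> Q) \<rhd> R" using * 1 by (simp add: mat_refine_assoc)
      ultimately show ?thesis using * 1 \<open>Z \<noteq> 0\<close> by blast
    next
      case 2
      then have "efficiency P Q \<noteq> 0" using * by (simp add: efficiency_residual_right)
      moreover from this have "Z = (P \<rhd> Q) \<turnstile> \<R>" using * 2 by (simp add: mat_refine_residual)
      ultimately show ?thesis using * 2 \<open>Z \<noteq> 0\<close> by blast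
    qed
  next
    fix P assume "P \<in> \<P>" "Z = P \<turnstile> (\<Q> \<rhd>\<^sub>S \<R>)"
    then show ?thesis using \<open>Z \<noteq> 0\<close> by (auto simp: mat_residual_set_refine)
  qed
next
  fix Z assume "Z \<in> ?R"
  then have "Z \<noteq> 0" by blast
  from \<open>Z \<in> ?R\<close> consider
      P Q R where "P \<in> \<P>" "Q \<in> \<Q>" "R \<in> \<R>" "efficiency P Q \<noteq> 0" "efficiency Q R \<noteq> 0"
        "Z = (P \<rhd> Q) \<rhd> R"
    | P Q where "P \<in> \<P>" "Q \<in> \<Q>" "efficiency P Q \<noteq> 0" "Z = (P \<rhd> Q) \<turnstile> \<R>"
    | P where "P \<in> \<P>" "Z = P \<turnstile> \<Q>"
    by blast
  then show "Z \<in> ?L"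
  proof cases
    case 1
    then have "Q \<rhd> R \<in> \<Q> \<rhd>\<^sub>S \<R>" "efficiency P (Q \<rhd> R) \<noteq> 0" "Z = P \<rhd> (Q \<rhd> R)"
      using mat_refine_nonzero[OF \<R> QR]
      by (auto simp: set_refine_def efficiency_refine_right mat_refine_assoc)
    then show ?thesis
      using 1 \<open>Z \<noteq> 0\<close> unfolding set_refine_def[of \<P>] by blast
  next
    case 2
    \<comment> \<open>The scaled formula is used because \<open>mat_refine_residual\<close> already
      presupposes this.\<close>
    then have "Q \<turnstile> \<R> \<noteq> 0" using \<open>Z \<noteq> 0\<close> by (auto simp: mat_refine_residual_scaled)
    then have "Q \<turnstile> \<R> \<in> \<Q> \<rhd>\<^sub>S \<R>" "efficiency P (Q \<turnstile> \<R>) \<noteq> 0" "Z = P \<rhd> (Q \<turnstile> \<R>)"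
      using 2 by (auto simp: set_refine_def efficiency_residual_right mat_refine_residual)
    then show ?thesis
      using 2 \<open>Z \<noteq> 0\<close> unfolding set_refine_def[of \<P>] by blast
  next
    case 3
    then have "Z = P \<turnstile> (\<Q> \<rhd>\<^sub>S \<R>)" by (simp add: mat_residual_set_refine)
    then show ?thesis
      using 3 \<open>Z \<noteq> 0\<close> unfolding set_refine_def[of \<P>] by blast
  qed
qed

end

theorem theorem5p1:
  fixes f :: "'o::finite \<Rightarrow> 'u::finite"
    and g :: "'u \<Rightarrow> 'g::finite"
    and \<P> \<Q> \<R> :: "(real ^ 'o ^ 'o) set"
  assumes "orth_decomposition UNIV \<P>"
    and "orth_decomposition (induced_space f) \<Q>"
    and "orth_decomposition (induced_space (g \<circ> f)) \<R>"
    and "structure_balanced (induced_space f) \<Q> UNIV \<P>"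
    and "structure_balanced (induced_space (g \<circ> f)) \<R> (induced_space f) \<Q>"
  shows "(structure_balanced (induced_space (g \<circ> f)) \<R> UNIV \<P> \<and>
     (\<forall>P\<in>\<P>. \<forall>R\<in>\<R>. efficiency P R = (\<Sum>Q\<in>\<Q>. efficiency P Q * efficiency Q R))) \<and>
     (structure_balanced (induced_space (g \<circ> f)) \<R> UNIV (\<P> \<rhd>\<^sub>S \<Q>) \<and>
     (\<forall>P\<in>\<P>. \<forall>Q\<in>\<Q>. \<forall>R\<in>\<R>. efficiency P Q \<noteq> 0 \<longrightarrow>
        efficiency (P \<rhd> Q) R = efficiency P Q * efficiency Q R) \<and>
     (\<forall>P\<in>\<P>. \<forall>R\<in>\<R>. efficiency (P \<turnstile> \<Q>) R = 0)) \<and>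
     (structure_balanced (induced_space f) (\<Q> \<rhd>\<^sub>S \<R>) UNIV \<P> \<and>
     (\<forall>P\<in>\<P>. \<forall>Q\<in>\<Q>. \<forall>R\<in>\<R>. efficiency Q R \<noteq> 0 \<longrightarrow>
        efficiency P (Q \<rhd> R) = efficiency P Q) \<and>
     (\<forall>P\<in>\<P>. \<forall>Q\<in>\<Q>. Q \<turnstile> \<R> \<noteq> 0 \<longrightarrow> efficiency P (Q \<turnstile> \<R>) = efficiency P Q)) \<and>
     (orth_decomposition UNIV ((\<P> \<rhd>\<^sub>S \<Q>) \<rhd>\<^sub>S \<R>) \<and>
     orth_decomposition UNIV (\<P> \<rhd>\<^sub>S (\<Q> \<rhd>\<^sub>S \<R>)) \<and>
     (\<P> \<rhd>\<^sub>S \<Q>) \<rhd>\<^sub>S \<R> = \<P> \<rhd>\<^sub>S (\<Q> \<rhd>\<^sub>S \<R>) \<and>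
     (\<P> \<rhd>\<^sub>S \<Q>) \<rhd>\<^sub>S \<R> =
       ({(P \<rhd> Q) \<rhd> R | P Q R. P \<in> \<P> \<and> Q \<in> \<Q> \<and> R \<in> \<R> \<and>
            efficiency P Q \<noteq> 0 \<and> efficiency Q R \<noteq> 0} \<union>
        {(P \<rhd> Q) \<turnstile> \<R> | P Q. P \<in> \<P> \<and> Q \<in> \<Q> \<and> efficiency P Q \<noteq> 0} \<union>
        {P \<turnstile> \<Q> | P. P \<in> \<P>}) - {0})"
proof -
  note P = assms(1) and Q = assms(2) and R = assms(3) and PQ = assms(4) and QR = assms(5)
  have chain: "orth_idempotents \<P>" "orth_idempotents \<Q>" "orth_idempotents \<R>"
    "\<And>P. P \<in> \<P> \<Longrightarrow> balanced_for P \<Q>" "\<And>Q. Q \<in> \<Q> \<Longrightarrow> balanced_for Q \<R>"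
    and sub: "induced_space (g \<circ> f) \<subseteq> induced_space f"
    using P Q R PQ QR by (simp_all add: orth_decomposition_iff structure_balanced_iff)
  \<comment> \<open>The inclusion of subspaces becomes the two absorption facts, which complete the
    hypotheses of the chain results.\<close>
  note chain = chain sum_mult_subdecomposition[OF Q R sub] subdecomposition_mult_sum[OF Q R sub]
  have PR: "structure_balanced (induced_space (g \<circ> f)) \<R> UNIV \<P>"
    using P R chain_balanced_for[OF chain] by (simp add: structure_balanced_iff)
  have PQ_R: "structure_balanced (induced_space (g \<circ> f)) \<R> UNIV (\<P> \<rhd>\<^sub>S \<Q>)"
    using R orth_decomposition_set_refine[OF PQ] balanced_for_set_refine_left[OF chain]
    by (simp add: structure_balanced_iff)
  have P_QR: "structure_balanced (induced_space f) (\<Q> \<rhd>\<^sub>S \<R>) UNIV \<P>"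
    using P orth_decomposition_set_refine[OF QR] balanced_for_set_refine_right[OF chain]
    by (simp add: structure_balanced_iff)
  \<comment> \<open>The balance statements in (b) and (c) are what make the two iterated refinements
    decompositions of the whole space.\<close>
  show ?thesis
    using PR PQ_R P_QR orth_decomposition_set_refine[OF PQ_R] orth_decomposition_set_refine[OF P_QR]
      chain_efficiency[OF chain] efficiency_refine_left[OF chain] efficiency_residual_left[OF chain]
      efficiency_refine_right[OF chain] efficiency_residual_right[OF chain]
      set_refine_set_refine_left[OF chain] set_refine_set_refine_right[OF chain]
    by (intro conjI ballI impI) simp_all
qed

end
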